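(* Let $0\le|\beta|<\alpha$, $\mu\in\mathbb{R}$ and let $X\sim\mathrm{AL}(\alpha,\beta,\mu)$. Then $$\mathbb{E}\big[|X-\mathbb{E}[X]|\big]=\frac{\alpha+|\beta|}{\alpha(\alpha-|\beta|)}\exp\bigg\{-\frac{2|\beta|}{\alpha+|\beta|}\bigg\}.$$
   Context: $\mathrm{AL}(\alpha,\beta,\mu)$ denotes the asymmetric Laplace distribution, with probability density function $p(x)=\frac{\alpha^2-\beta^2}{2\alpha}\,\mathrm{e}^{\beta(x-\mu)-\alpha|x-\mu|}$, $x\in\mathbb{R}$. *)

theory Defs
  imports "HOL-Probability.Probability"
begin

definition asym_laplace_density :: "real \<Rightarrow> real \<Rightarrow> real \<Rightarrow> real \<Rightarrow> real" where
  "asym_laplace_density \<alpha> \<beta> \<mu> x =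
     (\<alpha>\<^sup>2 - \<beta>\<^sup>2) / (2 * \<alpha>) * exp (\<beta> * (x - \<mu>) - \<alpha> * \<bar>x - \<mu>\<bar>)"

end

theory Submission
  imports Defs
begin

text \<open>
  Since \<open>X - E X\<close> has mean zero, \<open>E \<bar>X - E X\<bar> = 2 E (X - E X)\<^sup>+\<close>. To the right of any \<open>c \<ge> \<mu>\<close> the
  density is \<open>P (X > c)\<close> times the exponential density with rate \<open>\<alpha> - \<beta>\<close> started at \<open>c\<close>, so
  \<open>E (X - c)\<^sup>+\<close> is this probability times the exponential mean \<open>1 / (\<alpha> - \<beta>)\<close>. For \<open>\<beta> \<ge> 0\<close> this
  applies to \<open>c = E X\<close>, which lies to the right of \<open>\<mu>\<close>. The left half of the distribution and the
  case \<open>\<beta> < 0\<close> follow by reflection, as \<open>- X\<close> is distributed as \<open>AL(\<alpha>, - \<beta>, - \<mu>)\<close>.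
\<close>

lemma has_bochner_integral_pos_diff_neg:
  fixes f :: "'a \<Rightarrow> real"
  assumes "has_bochner_integral M (\<lambda>x. max 0 (f x)) p"
    and "has_bochner_integral M (\<lambda>x. max 0 (- f x)) n"
  shows "has_bochner_integral M f (p - n)"
proof -
  have "max 0 (f x) - max 0 (- f x) = f x" for x
    by (simp add: max_def)
  then show ?thesis
    using has_bochner_integral_diff[OF assms] by simp
qed

lemma distributed_has_bochner_integral:
  fixes g :: "'b \<Rightarrow> real"
  assumes "distributed M N X (\<lambda>x. ennreal (f x))" and "\<And>x. x \<in> space N \<Longrightarrow> 0 \<le> f x"
    and "g \<in> borel_measurable N" and "has_bochner_integral N (\<lambda>x. f x * g x) r"
  shows "has_bochner_integral M (\<lambda>\<omega>. g (X \<omega>)) r"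
  using assms distributed_integrable[of M N X f g] distributed_integral[of M N X f g]
  by (simp add: has_bochner_integral_iff)

lemma has_bochner_integral_erlang_density_power:
  assumes "0 < l"
  shows "has_bochner_integral lborel (\<lambda>x. erlang_density k l x * x ^ i)
    (fact (k + i) / (fact k * l ^ i))"
proof (rule has_bochner_integral_nn_integral)
  show "AE x in lborel. 0 \<le> erlang_density k l x * x ^ i"
    using assms by (simp add: erlang_density_def)
qed (use assms nn_integral_erlang_ith_moment in auto)

lemma (in prob_space) expectation_abs_deviation:
  fixes X :: "'a \<Rightarrow> real"
  assumes "integrable M X"
  shows "expectation (\<lambda>\<omega>. \<bar>X \<omega> - expectation X\<bar>) =
    2 * expectation (\<lambda>\<omega>. max 0 (X \<omega> - expectation X))"
proof -
  have "\<bar>x\<bar> = 2 * max 0 x - x" for x :: real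
    by (simp add: max_def)
  then have "expectation (\<lambda>\<omega>. \<bar>X \<omega> - expectation X\<bar>) =
      expectation (\<lambda>\<omega>. 2 * max 0 (X \<omega> - expectation X) - (X \<omega> - expectation X))"
    by simp
  also have "\<dots> = 2 * expectation (\<lambda>\<omega>. max 0 (X \<omega> - expectation X))"
    using assms by (simp add: prob_space)
  finally show ?thesis .
qed

lemma (in prob_space) distributed_lborel_uminus:
  fixes X :: "'a \<Rightarrow> real"
  assumes "distributed M lborel X f"
  shows "distributed M lborel (\<lambda>\<omega>. - X \<omega>) (\<lambda>x. f (- x))"
  using distributed_affine[OF assms, of "-1" 0] by (simp add: divide_ennreal_def)

lemma asym_laplace_density_nonneg:
  assumes "\<bar>\<beta>\<bar> \<le> \<alpha>"
  shows "0 \<le> asym_laplace_density \<alpha> \<beta> \<mu> x"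
proof -
  have "\<beta>\<^sup>2 \<le> \<alpha>\<^sup>2"
    using assms by (simp add: abs_le_square_iff[symmetric])
  then show ?thesis
    using assms by (simp add: asym_laplace_density_def)
qed

lemma asym_laplace_density_uminus:
  "asym_laplace_density \<alpha> \<beta> \<mu> (- x) = asym_laplace_density \<alpha> (- \<beta>) (- \<mu>) x"
proof -
  have "\<bar>- x - \<mu>\<bar> = \<bar>x - - \<mu>\<bar>" and "\<beta> * (- x - \<mu>) = - \<beta> * (x - - \<mu>)"
    by (simp_all add: algebra_simps)
  then show ?thesis
    unfolding asym_laplace_density_def by simp
qed

lemma asym_laplace_density_eq_shifted_exponential:
  assumes "\<mu> \<le> c" and "c \<le> x"
  shows "asym_laplace_density \<alpha> \<beta> \<mu> x =
    (\<alpha> + \<beta>) / (2 * \<alpha>) * exp (- (\<alpha> - \<beta>) * (c - \<mu>)) * exponential_density (\<alpha> - \<beta>) (x - c)"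
proof -
  have "\<beta> * (x - \<mu>) - \<alpha> * \<bar>x - \<mu>\<bar> = - (\<alpha> - \<beta>) * (c - \<mu>) + - (x - c) * (\<alpha> - \<beta>)"
    using assms by (simp add: algebra_simps)
  then have "exp (\<beta> * (x - \<mu>) - \<alpha> * \<bar>x - \<mu>\<bar>) =
      exp (- (\<alpha> - \<beta>) * (c - \<mu>)) * exp (- (x - c) * (\<alpha> - \<beta>))"
    by (simp only: exp_add)
  moreover have "\<alpha>\<^sup>2 - \<beta>\<^sup>2 = (\<alpha> + \<beta>) * (\<alpha> - \<beta>)"
    by (simp add: power2_eq_square square_diff_square_factored)
  ultimately show ?thesis
    using assms by (simp add: asym_laplace_density_def exponential_density_def)
qed

locale asym_laplace = prob_space M for M :: "'a measure" +
  fixes X :: "'a \<Rightarrow> real" and \<alpha> \<beta> \<mu> :: real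
  assumes abs_\<beta>_less: "\<bar>\<beta>\<bar> < \<alpha>"
    and distributed_X: "distributed M lborel X (\<lambda>x. ennreal (asym_laplace_density \<alpha> \<beta> \<mu> x))"
begin

lemma rates_pos: "0 < \<alpha> - \<beta>" "0 < \<alpha> + \<beta>"
  using abs_\<beta>_less by linarith+

lemma asym_laplace_uminus: "asym_laplace M (\<lambda>\<omega>. - X \<omega>) \<alpha> (- \<beta>) (- \<mu>)"
proof
  show "\<bar>- \<beta>\<bar> < \<alpha>"
    using abs_\<beta>_less by simp
  show "distributed M lborel (\<lambda>\<omega>. - X \<omega>) (\<lambda>x. ennreal (asym_laplace_density \<alpha> (- \<beta>) (- \<mu>) x))"
    using distributed_lborel_uminus[OF distributed_X] by (simp add: asym_laplace_density_uminus)
qed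

lemma has_bochner_integral_excess:
  assumes "\<mu> \<le> c"
  shows "has_bochner_integral M (\<lambda>\<omega>. max 0 (X \<omega> - c))
    ((\<alpha> + \<beta>) / (2 * \<alpha> * (\<alpha> - \<beta>)) * exp (- (\<alpha> - \<beta>) * (c - \<mu>)))"
proof (rule distributed_has_bochner_integral[OF distributed_X])
  let ?tail = "(\<alpha> + \<beta>) / (2 * \<alpha>) * exp (- (\<alpha> - \<beta>) * (c - \<mu>))"
  have "has_bochner_integral lborel (\<lambda>x. exponential_density (\<alpha> - \<beta>) x * x) (1 / (\<alpha> - \<beta>))"
    using has_bochner_integral_erlang_density_power[OF rates_pos(1), of 0 1] by simp
  then have "has_bochner_integral lborel (\<lambda>x. exponential_density (\<alpha> - \<beta>) (x - c) * (x - c))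
      (1 / (\<alpha> - \<beta>))"
    using lborel_has_bochner_integral_real_affine_iff
      [of 1 "\<lambda>x. exponential_density (\<alpha> - \<beta>) x * x" _ "- c"] by simp
  then have "has_bochner_integral lborel
      (\<lambda>x. ?tail * (exponential_density (\<alpha> - \<beta>) (x - c) * (x - c))) (?tail * (1 / (\<alpha> - \<beta>)))"
    by (rule has_bochner_integral_mult_right)
  moreover have "asym_laplace_density \<alpha> \<beta> \<mu> x * max 0 (x - c) =
      ?tail * (exponential_density (\<alpha> - \<beta>) (x - c) * (x - c))" for x
  proof (cases "c \<le> x")
    case True
    then show ?thesis
      by (simp add: asym_laplace_density_eq_shifted_exponential[OF assms])
  next
    case False
    then show ?thesis
      by (simp add: exponential_density_def)
  qed
  ultimately show "has_bochner_integral lborel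
      (\<lambda>x. asym_laplace_density \<alpha> \<beta> \<mu> x * max 0 (x - c))
      ((\<alpha> + \<beta>) / (2 * \<alpha> * (\<alpha> - \<beta>)) * exp (- (\<alpha> - \<beta>) * (c - \<mu>)))"
    by simp
qed (use abs_\<beta>_less in \<open>simp_all add: asym_laplace_density_nonneg\<close>)

lemma has_bochner_integral_X: "has_bochner_integral M X (\<mu> + 2 * \<beta> / ((\<alpha> - \<beta>) * (\<alpha> + \<beta>)))"
proof -
  interpret reflected: asym_laplace M "\<lambda>\<omega>. - X \<omega>" \<alpha> "- \<beta>" "- \<mu>"
    by (rule asym_laplace_uminus)
  have "has_bochner_integral M (\<lambda>\<omega>. X \<omega> - \<mu>)
      ((\<alpha> + \<beta>) / (2 * \<alpha> * (\<alpha> - \<beta>)) - (\<alpha> - \<beta>) / (2 * \<alpha> * (\<alpha> + \<beta>)))"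
    using has_bochner_integral_excess[of \<mu>] reflected.has_bochner_integral_excess[of "- \<mu>"]
    by (intro has_bochner_integral_pos_diff_neg) simp_all
  also have "(\<alpha> + \<beta>) / (2 * \<alpha> * (\<alpha> - \<beta>)) - (\<alpha> - \<beta>) / (2 * \<alpha> * (\<alpha> + \<beta>)) =
      2 * \<beta> / ((\<alpha> - \<beta>) * (\<alpha> + \<beta>))"
    using rates_pos by (simp add: divide_simps) (simp add: algebra_simps)
  finally have "has_bochner_integral M (\<lambda>\<omega>. X \<omega> - \<mu>) (2 * \<beta> / ((\<alpha> - \<beta>) * (\<alpha> + \<beta>)))" .
  moreover have "has_bochner_integral M (\<lambda>\<omega>. \<mu>) \<mu>"
    by (simp add: has_bochner_integral_iff prob_space)
  ultimately show ?thesis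
    using has_bochner_integral_add[of M "\<lambda>\<omega>. \<mu>" \<mu> "\<lambda>\<omega>. X \<omega> - \<mu>"] by simp
qed

lemma expectation_abs_deviation_of_nonneg_\<beta>:
  assumes "0 \<le> \<beta>"
  shows "expectation (\<lambda>\<omega>. \<bar>X \<omega> - expectation X\<bar>) =
    (\<alpha> + \<beta>) / (\<alpha> * (\<alpha> - \<beta>)) * exp (- (2 * \<beta> / (\<alpha> + \<beta>)))"
proof -
  have integrable: "integrable M X"
    and mean: "expectation X = \<mu> + 2 * \<beta> / ((\<alpha> - \<beta>) * (\<alpha> + \<beta>))"
    using has_bochner_integral_X by (auto simp: has_bochner_integral_iff)
  have "\<mu> \<le> expectation X"
    using assms rates_pos by (simp add: mean)
  have exponent: "- (\<alpha> - \<beta>) * (expectation X - \<mu>) = - (2 * \<beta> / (\<alpha> + \<beta>))"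
    using rates_pos unfolding mean by (simp add: divide_simps) (simp add: algebra_simps)
  have "expectation (\<lambda>\<omega>. \<bar>X \<omega> - expectation X\<bar>) =
      2 * expectation (\<lambda>\<omega>. max 0 (X \<omega> - expectation X))"
    using integrable by (rule expectation_abs_deviation)
  also have "\<dots> = 2 * ((\<alpha> + \<beta>) / (2 * \<alpha> * (\<alpha> - \<beta>)) * exp (- (2 * \<beta> / (\<alpha> + \<beta>))))"
    using has_bochner_integral_excess[OF \<open>\<mu> \<le> expectation X\<close>]
    unfolding exponent by (simp add: has_bochner_integral_integral_eq)
  finally show ?thesis
    by simp
qed

end

theorem mainTheorem8:
  fixes M :: "'a measure" and X :: "'a \<Rightarrow> real" and \<alpha> \<beta> \<mu> :: real
  assumes "prob_space M"
    and "0 \<le> \<bar>\<beta>\<bar>" and "\<bar>\<beta>\<bar> < \<alpha>"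
    and "distributed M lborel X (\<lambda>x. ennreal (asym_laplace_density \<alpha> \<beta> \<mu> x))"
  shows "prob_space.expectation M (\<lambda>\<omega>. \<bar>X \<omega> - prob_space.expectation M X\<bar>) =
           (\<alpha> + \<bar>\<beta>\<bar>) / (\<alpha> * (\<alpha> - \<bar>\<beta>\<bar>)) * exp (- (2 * \<bar>\<beta>\<bar> / (\<alpha> + \<bar>\<beta>\<bar>)))"
proof -
  interpret asym_laplace M X \<alpha> \<beta> \<mu>
    using assms by (simp add: asym_laplace_def asym_laplace_axioms_def)
  show ?thesis
  proof (cases "0 \<le> \<beta>")
    case True
    then show ?thesis
      using expectation_abs_deviation_of_nonneg_\<beta> by simp
  next
    case False
    interpret reflected: asym_laplace M "\<lambda>\<omega>. - X \<omega>" \<alpha> "- \<beta>" "- \<mu>"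
      by (rule asym_laplace_uminus)
    have "\<bar>X \<omega> - expectation X\<bar> = \<bar>- X \<omega> - expectation (\<lambda>\<omega>. - X \<omega>)\<bar>" for \<omega>
      by simp
    then show ?thesis
      using reflected.expectation_abs_deviation_of_nonneg_\<beta> False by simp
  qed
qed

end
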